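(* For a consecutive pattern $\sigma\in\mathcal S_3$ let $F_\sigma(q,x,z)=\sum_{n\ge0}\sum_{\pi\in\mathcal S_n}q^{\mathrm{occ}_\sigma(\pi)}x^{\mathrm{cyc}(\pi)}z^n$. Then $F_{213}(q,x,z)=F_{231}(q,x,z)=F_{312}(q,x,z)$.
   Context: $\mathcal S_n$ is the set of permutations of $[n]$; $\mathcal S_0$ contains only the empty permutation. The standard cycle form writes each cycle starting with its smallest element, cycles listed in decreasing order of smallest elements. $\Psi(\pi)$ is the word obtained by deleting parentheses from the standard cycle form; $\mathrm{cyc}(\pi)$ is the number of cycles. $\mathrm{occ}_\sigma(\pi)$ (cyclic occurrences of the consecutive pattern $\sigma$) is the number of positions $i$ such that $\Psi(\pi)_i,\Psi(\pi)_{i+1},\Psi(\pi)_{i+2}$ lie in the same cycle and are order-isomorphic to $\sigma$. *)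

theory Defs
  imports
    "HOL-Combinatorics.Combinatorics"
    "HOL-Computational_Algebra.Computational_Algebra"
begin

(* The list "support p a" is the cycle (a, p a, p (p a), ...), written starting with a. *)
definition standard_cycle_form :: "nat \<Rightarrow> (nat \<Rightarrow> nat) \<Rightarrow> nat list list" where
  "standard_cycle_form n p =
     map (support p) (rev (sorted_list_of_set {a \<in> {1..n}. \<forall>b \<in> orbit p a. a \<le> b}))"

definition cycle_word :: "nat \<Rightarrow> (nat \<Rightarrow> nat) \<Rightarrow> nat list" where
  "cycle_word n p = concat (standard_cycle_form n p)"

definition cyc :: "nat \<Rightarrow> (nat \<Rightarrow> nat) \<Rightarrow> nat" where
  "cyc n p = length (standard_cycle_form n p)"

definition order_isomorphic :: "nat list \<Rightarrow> nat list \<Rightarrow> bool" where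
  "order_isomorphic u v \<longleftrightarrow> length u = length v \<and>
     (\<forall>i < length u. \<forall>j < length u. u ! i < u ! j \<longleftrightarrow> v ! i < v ! j)"

(* The pattern s is given in one-line notation; positions are counted from 0. *)
definition occ :: "nat list \<Rightarrow> nat \<Rightarrow> (nat \<Rightarrow> nat) \<Rightarrow> nat" where
  "occ s n p = (let w = cycle_word n p in
     card {i. i + 2 < length w \<and>
              (\<exists>c \<in> set (standard_cycle_form n p). {w ! i, w ! (i+1), w ! (i+2)} \<subseteq> set c) \<and>
              order_isomorphic [w ! i, w ! (i+1), w ! (i+2)] s})"

(* The coefficients of the power series in z are polynomials in x over the polynomials in q. *)
definition var_q :: "int poly poly" where "var_q = [:[:0, 1:]:]"
definition var_x :: "int poly poly" where "var_x = [:0, 1:]"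

definition F :: "nat list \<Rightarrow> int poly poly fps" where
  "F s = Abs_fps (\<lambda>n. \<Sum>p | p permutes {1..n}. var_q ^ occ s n p * var_x ^ cyc n p)"

end

theory Submission
  imports Defs
begin

text \<open>
  None of the three patterns starts with its smallest letter, so an occurrence never uses the smallest
  element of a cycle: if \<open>m\<close> is this element, then the occurrences within the cycle \<open>(m, a\<^sub>1, \<dots>, a\<^sub>k)\<close>
  are those within the word \<open>a\<^sub>1 \<dots> a\<^sub>k\<close>. Reversing all these words amounts to inverting the
  permutation, and turns 213 into 312. Complementing each of them amounts to conjugating the
  permutation by an involution that depends only on its orbits, and turns 213 into 231.
\<close>

section \<open>Occurrences by starting letter, and words made of blocks\<close>

definition orbit_min :: "(nat \<Rightarrow> nat) \<Rightarrow> nat \<Rightarrow> bool" where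
  "orbit_min p a \<longleftrightarrow> (\<forall>b \<in> orbit p a. a \<le> b)"

text \<open>An occurrence is recorded by its first letter instead of its position. The conditions on
  \<open>p a\<close> and \<open>p (p a)\<close> keep the triple from wrapping round to the head of
  the cycle; with the same condition on \<open>a\<close>, the set behaves symmetrically under
  reversal.\<close>

definition interior_occ :: "nat list \<Rightarrow> nat \<Rightarrow> (nat \<Rightarrow> nat) \<Rightarrow> nat set" where
  "interior_occ s n p = {a \<in> {1..n}. \<not> orbit_min p a \<and> \<not> orbit_min p (p a) \<and>
     \<not> orbit_min p (p (p a)) \<and> order_isomorphic [a, p a, p (p a)] s}"

lemma order_isomorphic_triple:
  "order_isomorphic [a, b, c] [2,1,3] \<longleftrightarrow> b < a \<and> a < c"
  "order_isomorphic [a, b, c] [2,3,1] \<longleftrightarrow> c < a \<and> a < b"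
  "order_isomorphic [a, b, c] [3,1,2] \<longleftrightarrow> b < c \<and> c < a"
  by (auto simp: order_isomorphic_def less_Suc_eq numeral_3_eq_3 numeral_2_eq_2)

text \<open>Distinctness gives each letter a single position, so the letters of \<open>c\<close>
  occur nowhere outside its own block. Here \<open>k\<close> is the total length of the preceding
  blocks.\<close>

lemma distinct_concat_block:
  assumes "distinct (concat L)" "c \<in> set L"
  obtains k where "k + length c \<le> length (concat L)"
    "\<And>j. j < length c \<Longrightarrow> concat L ! (k + j) = c ! j"
    "\<And>i. i < length (concat L) \<Longrightarrow> concat L ! i \<in> set c \<Longrightarrow> k \<le> i \<and> i < k + length c"
proof -
  obtain xs ys where L: "L = xs @ c # ys" using assms(2) by (meson split_list)
  let ?k = "length (concat xs)"
  have nth: "concat L ! (?k + j) = c ! j" if "j < length c" for j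
    using that by (simp add: L nth_append)
  show thesis
  proof (rule that[of ?k])
    show len: "?k + length c \<le> length (concat L)" by (simp add: L)
    show "concat L ! (?k + j) = c ! j" if "j < length c" for j using nth[OF that] .
    fix i assume i: "i < length (concat L)" "concat L ! i \<in> set c"
    then obtain j where j: "j < length c" "c ! j = concat L ! i" by (metis in_set_conv_nth)
    then have "concat L ! (?k + j) = concat L ! i" using nth by simp
    then have "i = ?k + j"
      using assms(1) i(1) j(1) len by (simp add: nth_eq_iff_index_eq)
    then show "?k \<le> i \<and> i < ?k + length c" using j by simp
  qed
qed

subsection \<open>Cycles and orbits\<close>

lemma orbit_eqI_permutation:
  assumes "permutation p" "y \<in> orbit p x"
  shows "orbit p y = orbit p x"
  using orbit_cyclic_eq3[OF cyclic_on_orbit'[OF assms(1)] assms(2)] .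

lemma finite_orbit_permutation: "permutation p \<Longrightarrow> finite (orbit p x)"
  by (simp add: finite_orbit permutation_self_in_orbit)

lemma set_support_eq_orbit: "permutation p \<Longrightarrow> set (support p a) = orbit p a"
  by (subst support_set) (auto simp: orbit_altdef_permutation)

lemma orbit_min_iff_Min:
  assumes "permutation p"
  shows "orbit_min p a \<longleftrightarrow> a = Min (orbit p a)"
  using permutation_self_in_orbit[OF assms, of a] finite_orbit_permutation[OF assms, of a]
  unfolding orbit_min_def by (metis Min_eqI Min_le)

lemma orbit_min_unique:
  assumes "permutation p" "orbit_min p a" "orbit_min p b" "b \<in> orbit p a"
  shows "a = b"
  using assms orbit_min_iff_Min orbit_eqI_permutation by metis

lemma set_standard_cycle_form:
  "set (standard_cycle_form n p) = support p ` {a \<in> {1..n}. orbit_min p a}"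
  unfolding standard_cycle_form_def orbit_min_def by simp

lemma cyc_eq_card: "cyc n p = card {a \<in> {1..n}. orbit_min p a}"
  unfolding cyc_def standard_cycle_form_def orbit_min_def by simp

lemma distinct_cycle_word:
  assumes "permutation p"
  shows "distinct (cycle_word n p)"
  unfolding cycle_word_def
proof (rule distinct_concat)
  let ?M = "{a \<in> {1..n}. orbit_min p a}"
  \<comment> \<open>Two different minima lie in different orbits, and different orbits are
    disjoint.\<close>
  have *: "set (support p a) \<inter> set (support p b) = {}" if "a \<in> ?M" "b \<in> ?M" "a \<noteq> b" for a b
    using that orbit_min_unique[OF assms] set_support_eq_orbit[OF assms] disjoint_support'[OF assms]
    by (metis (mono_tags, lifting) mem_Collect_eq)
  have "inj_on (support p) ?M"
  proof (rule inj_onI, rule ccontr)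
    fix a b assume ab: "a \<in> ?M" "b \<in> ?M" "support p a = support p b" "a \<noteq> b"
    have "a \<in> set (support p a)"
      using permutation_self_in_orbit[OF assms] set_support_eq_orbit[OF assms] by blast
    then show False using *[OF ab(1,2,4)] ab(3) by simp
  qed
  then show "distinct (standard_cycle_form n p)"
    unfolding standard_cycle_form_def orbit_min_def by (simp add: distinct_map)
  show "distinct c" if "c \<in> set (standard_cycle_form n p)" for c
    using that cycle_of_permutation[OF assms] unfolding set_standard_cycle_form by blast
  show "set c \<inter> set d = {}"
    if "c \<in> set (standard_cycle_form n p)" "d \<in> set (standard_cycle_form n p)" "c \<noteq> d" for c d
    using that * unfolding set_standard_cycle_form by blast
qed

text \<open>The first return to \<open>m\<close> takes \<open>least_power p m\<close> steps, so the
  earlier iterates differ from \<open>m\<close>, and an orbit has only one minimum.\<close>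

lemma support_nth_not_orbit_min:
  assumes "permutation p" "orbit_min p m" "0 < j" "j < least_power p m"
  shows "\<not> orbit_min p ((p ^^ j) m)"
proof
  assume "orbit_min p ((p ^^ j) m)"
  then have "m = (p ^^ j) m"
    using orbit_min_unique assms(1,2) orbit_altdef_permutation[OF assms(1)] by blast
  then show False using least_power_le[of j p m] assms(3,4) by simp
qed

subsection \<open>Occurrences in terms of orbits\<close>

text \<open>The hypothesis on \<open>s\<close> says that its first letter is not its smallest, so no
  occurrence starts at the head of a cycle. Sending a position to its letter is then the required
  bijection.\<close>

lemma occ_eq_card_interior_occ:
  assumes perm: "p permutes {1..n}"
    and s: "\<And>a b c. order_isomorphic [a, b, c] s \<Longrightarrow> b < a \<or> c < a"
  shows "occ s n p = card (interior_occ s n p)"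
proof -
  have p: "permutation p" using perm permutation_permutes by blast
  define w where "w = cycle_word n p"
  define L where "L = standard_cycle_form n p"
  have w: "w = concat L" by (simp add: w_def L_def cycle_word_def)
  have dw: "distinct w" by (simp add: w_def distinct_cycle_word[OF p])
  have L: "set L = support p ` {a \<in> {1..n}. orbit_min p a}"
    by (simp add: L_def set_standard_cycle_form)
  define I where "I = {i. i + 2 < length w \<and>
              (\<exists>c \<in> set L. {w ! i, w ! (i+1), w ! (i+2)} \<subseteq> set c) \<and>
              order_isomorphic [w ! i, w ! (i+1), w ! (i+2)] s}"
  \<comment> \<open>The cycle with minimum \<open>m\<close> fills exactly the positions from
    \<open>k\<close> to \<open>k + least_power p m - 1\<close>, in the order of iteration.\<close>
  have block: "\<exists>k. k + least_power p m \<le> length w \<and>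
       (\<forall>j < least_power p m. w ! (k + j) = (p ^^ j) m) \<and>
       (\<forall>i < length w. w ! i \<in> orbit p m \<longrightarrow> k \<le> i \<and> i < k + least_power p m)"
    if "m \<in> {1..n}" "orbit_min p m" for m
  proof -
    have "support p m \<in> set L" using L that by blast
    from distinct_concat_block[OF dw[unfolded w] this] obtain k where
      "k + length (support p m) \<le> length (concat L)"
      "\<And>j. j < length (support p m) \<Longrightarrow> concat L ! (k + j) = support p m ! j"
      "\<And>i. i < length (concat L) \<Longrightarrow> concat L ! i \<in> set (support p m) \<Longrightarrow>
        k \<le> i \<and> i < k + length (support p m)" by blast
    then show ?thesis unfolding set_support_eq_orbit[OF p] w[symmetric] by auto
  qed
  have "bij_betw (\<lambda>i. w ! i) I (interior_occ s n p)"
  proof (rule bij_betw_imageI)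
    show "inj_on (\<lambda>i. w ! i) I"
      using dw by (auto simp: I_def inj_on_def nth_eq_iff_index_eq)
    show "(\<lambda>i. w ! i) ` I = interior_occ s n p"
    proof (intro equalityI subsetI)
      fix a assume "a \<in> (\<lambda>i. w ! i) ` I"
      then obtain i where i: "i \<in> I" "a = w ! i" by blast
      then obtain m where m: "m \<in> {1..n}" "orbit_min p m"
        "{w ! i, w ! (i+1), w ! (i+2)} \<subseteq> orbit p m"
        unfolding I_def L using set_support_eq_orbit[OF p] by auto
      from block[OF m(1,2)] obtain k where k: "k + least_power p m \<le> length w"
        "\<And>j. j < least_power p m \<Longrightarrow> w ! (k + j) = (p ^^ j) m"
        "\<And>i. i < length w \<Longrightarrow> w ! i \<in> orbit p m \<Longrightarrow> k \<le> i \<and> i < k + least_power p m"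
        by blast
      have len: "i + 2 < length w" using i by (simp add: I_def)
      define j where "j = i - k"
      \<comment> \<open>Both ends of the triple, \<open>i\<close> and \<open>i + 2\<close>, lie in
        the block.\<close>
      have j: "i = k + j" "j + 2 < least_power p m"
        using k(3)[of i] k(3)[of "i+2"] len m(3) by (auto simp: j_def)
      have a: "w ! i = (p ^^ j) m" "w ! (i+1) = p a" "w ! (i+2) = p (p a)"
        using k(2)[of j] k(2)[of "j+1"] k(2)[of "j+2"] j i(2) by (simp_all add: add.assoc)
      have oi: "order_isomorphic [a, p a, p (p a)] s"
        using i a by (simp add: I_def)
      \<comment> \<open>At offset 0 the triple would begin with the cycle minimum, against the
        hypothesis on \<open>s\<close>.\<close>
      have "j \<noteq> 0"
      proof
        assume "j = 0"
        then have "a = m" using a i by simp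
        then have "a \<le> p a" "a \<le> p (p a)"
          using m a unfolding orbit_min_def by auto
        then show False using s[OF oi] by auto
      qed
      then have "\<not> orbit_min p a" "\<not> orbit_min p (p a)" "\<not> orbit_min p (p (p a))"
        using support_nth_not_orbit_min[OF p m(2), of j]
          support_nth_not_orbit_min[OF p m(2), of "j+1"]
          support_nth_not_orbit_min[OF p m(2), of "j+2"] j a i by simp_all
      moreover have "a \<in> {1..n}"
        using permutes_orbit_subset[OF perm m(1)] m(3) i(2) by blast
      ultimately show "a \<in> interior_occ s n p" using oi unfolding interior_occ_def by blast
    next
      fix a assume "a \<in> interior_occ s n p"
      then have a: "a \<in> {1..n}" "\<not> orbit_min p (p a)" "\<not> orbit_min p (p (p a))"
        "order_isomorphic [a, p a, p (p a)] s" by (auto simp: interior_occ_def)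
      define m where "m = Min (orbit p a)"
      have m_in: "m \<in> orbit p a"
        unfolding m_def by (rule Min_in[OF finite_orbit_permutation[OF p] orbit_nonempty])
      then have orb: "orbit p m = orbit p a" by (rule orbit_eqI_permutation[OF p])
      have m: "m \<in> {1..n}" "orbit_min p m"
        using permutes_orbit_subset[OF perm a(1)] m_in orb
        by (auto simp: orbit_min_iff_Min[OF p] m_def)
      from block[OF m] obtain k where k: "k + least_power p m \<le> length w"
        "\<And>j. j < least_power p m \<Longrightarrow> w ! (k + j) = (p ^^ j) m" by blast
      have "a \<in> set (support p m)"
        using permutation_self_in_orbit[OF p] set_support_eq_orbit[OF p] orb by blast
      then obtain j where j: "j < least_power p m" "a = (p ^^ j) m" by auto
      \<comment> \<open>The last letter of a cycle is mapped back to \<open>m\<close>, so a letter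
        with a non-minimal image is not the last one.\<close>
      have end_cycle: "Suc i < least_power p m"
        if "i < least_power p m" "\<not> orbit_min p ((p ^^ Suc i) m)" for i
      proof (rule ccontr)
        assume "\<not> Suc i < least_power p m"
        then have "Suc i = least_power p m" using that by simp
        then have "(p ^^ Suc i) m = m" using least_power_of_permutation(1)[OF p] by metis
        then show False using m that by simp
      qed
      have j2: "j + 2 < least_power p m"
        using end_cycle[of j] end_cycle[of "Suc j"] a j by simp
      have eqs: "w ! (k + j) = a" "w ! (k + j + 1) = p a" "w ! (k + j + 2) = p (p a)"
        using k(2)[of j] k(2)[of "j+1"] k(2)[of "j+2"] j j2 by (simp_all add: add.assoc)
      have sub: "{a, p a, p (p a)} \<subseteq> set (support p m)"
        using set_support_eq_orbit[OF p] orb permutation_self_in_orbit[OF p]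
        by (auto intro: orbit.intros)
      have "k + j \<in> I"
        unfolding I_def mem_Collect_eq eqs
      proof (intro conjI)
        show "k + j + 2 < length w" using j2 k(1) by simp
        show "\<exists>c\<in>set L. {a, p a, p (p a)} \<subseteq> set c" using sub L m by blast
        show "order_isomorphic [a, p a, p (p a)] s" by fact
      qed
      then show "a \<in> (\<lambda>i. w ! i) ` I" using eqs(1) by blast
    qed
  qed
  then have "card I = card (interior_occ s n p)" by (rule bij_betw_same_card)
  then show ?thesis unfolding occ_def Let_def I_def w_def L_def by simp
qed

lemma cyc_cong_orbit:
  assumes "\<And>x. orbit p x = orbit p' x"
  shows "cyc n p = cyc n p'"
  using assms by (simp add: cyc_eq_card orbit_min_def)

text \<open>Reindexing each coefficient along \<open>f\<close>; as an involution, \<open>f\<close>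
  supplies both directions of the bijection.\<close>

lemma F_eqI:
  assumes bij: "\<And>n p. p permutes {1..n} \<Longrightarrow> f p permutes {1..n} \<and> f (f p) = p"
    and "\<And>n p. p permutes {1..n} \<Longrightarrow> cyc n (f p) = cyc n p"
    and "\<And>n p. p permutes {1..n} \<Longrightarrow> occ t n (f p) = occ s n p"
  shows "F s = F t"
proof -
  have "(\<Sum>p | p permutes {1..n}. var_q ^ occ s n p * var_x ^ cyc n p) =
    (\<Sum>p | p permutes {1..n}. var_q ^ occ t n p * var_x ^ cyc n p)" for n
    by (rule sum.reindex_bij_witness[of _ f f]) (auto simp: assms simp del: One_nat_def)
  then show ?thesis unfolding F_def by simp
qed

subsection \<open>Reversal of the cycles\<close>

lemma occ_inv:
  assumes perm: "p permutes {1..n}"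
  shows "occ [3,1,2] n (inv p) = occ [2,1,3] n p"
proof -
  have p: "permutation p" using perm permutation_permutes by blast
  have inv: "inv p permutes {1..n}" using perm by (rule permutes_inv)
  have om: "orbit_min (inv p) = orbit_min p"
    by (simp add: fun_eq_iff orbit_min_def orbit_inv_eq[OF p])
  have pp: "inv p (p x) = x" "p (inv p x) = x" for x
    using permutes_inverses[OF perm] by simp_all
  have in_iff: "p x \<in> {1..n} \<longleftrightarrow> x \<in> {1..n}" "inv p x \<in> {1..n} \<longleftrightarrow> x \<in> {1..n}" for x
    using permutes_in_image[OF perm] permutes_in_image[OF inv] by blast+
  \<comment> \<open>Reading backwards, the triple that starts at \<open>a\<close> under
    \<open>p\<close> starts at its old last letter \<open>p (p a)\<close> under
    \<open>inv p\<close>.\<close>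
  have "bij_betw (\<lambda>a. p (p a)) (interior_occ [2,1,3] n p) (interior_occ [3,1,2] n (inv p))"
    by (rule bij_betw_byWitness[where f' = "\<lambda>a. inv p (inv p a)"])
      (auto simp: interior_occ_def om pp order_isomorphic_triple in_iff simp del: atLeastAtMost_iff One_nat_def)
  then have "card (interior_occ [2,1,3] n p) = card (interior_occ [3,1,2] n (inv p))"
    by (rule bij_betw_same_card)
  moreover have "occ [2,1,3] n p = card (interior_occ [2,1,3] n p)"
    by (rule occ_eq_card_interior_occ[OF perm]) (auto simp only: order_isomorphic_triple)
  moreover have "occ [3,1,2] n (inv p) = card (interior_occ [3,1,2] n (inv p))"
    by (rule occ_eq_card_interior_occ[OF inv]) (auto simp only: order_isomorphic_triple)
  ultimately show ?thesis by simp
qed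

lemma F_213_312: "F [2,1,3] = F [3,1,2]"
proof (rule F_eqI[where f = inv])
  fix n and p :: "nat \<Rightarrow> nat" assume p: "p permutes {1..n}"
  show "inv p permutes {1..n} \<and> inv (inv p) = p"
    using p by (simp add: permutes_inv permutes_inv_inv)
  show "cyc n (inv p) = cyc n p"
    using p permutation_permutes by (intro cyc_cong_orbit orbit_inv_eq) blast
qed (rule occ_inv)

subsection \<open>Complementation of the cycles\<close>

text \<open>Enumerate \<open>B\<close> increasingly from index 0 and exchange the indices
  \<open>i\<close> and \<open>card B - 1 - i\<close>.\<close>

lemma ex_order_reversing_involution:
  fixes B :: "nat set"
  assumes "finite B"
  shows "\<exists>f. (\<forall>x\<in>B. f x \<in> B \<and> f (f x) = x) \<and> (\<forall>x. x \<notin> B \<longrightarrow> f x = x) \<and>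
    (\<forall>x\<in>B. \<forall>y\<in>B. f x < f y \<longleftrightarrow> y < x)"
proof -
  obtain h where h: "bij_betw h {..<card B} B" "strict_mono_on {..<card B} h"
    using ex_bij_betw_strict_mono_card[OF assms] by blast
  define g where "g = inv_into {..<card B} h"
  define f where "f x = (if x \<in> B then h (card B - 1 - g x) else x)" for x
  have g: "g x < card B" "h (g x) = x" if "x \<in> B" for x
    using that h(1) unfolding g_def
    by (metis bij_betw_def inv_into_into lessThan_iff, metis bij_betw_inv_into_right)
  have gh: "g (h i) = i" "h i \<in> B" if "i < card B" for i
    using that h(1) unfolding g_def
    by (meson bij_betw_inv_into_left lessThan_iff, meson bij_betwE lessThan_iff)
  have less: "h i < h j \<longleftrightarrow> i < j" if "i < card B" "j < card B" for i j
    using that strict_mono_on_less[OF h(2)] by simp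
  have f: "f x \<in> B" "g (f x) = card B - 1 - g x" if "x \<in> B" for x
    using that g[OF that] gh[of "card B - 1 - g x"] by (auto simp: f_def)
  have "f (f x) = x" if "x \<in> B" for x
    using f[OF that] g[OF that] by (subst f_def) simp
  moreover have "f x < f y \<longleftrightarrow> y < x" if "x \<in> B" "y \<in> B" for x y
  proof -
    have "f x < f y \<longleftrightarrow> card B - 1 - g x < card B - 1 - g y"
      using that g[OF that(1)] g[OF that(2)] by (simp add: f_def less)
    also have "\<dots> \<longleftrightarrow> g y < g x" using g(1)[OF that(1)] g(1)[OF that(2)] by auto
    also have "\<dots> \<longleftrightarrow> y < x" using less[of "g y" "g x"] g[OF that(1)] g[OF that(2)] by simp
    finally show ?thesis .
  qed
  ultimately show ?thesis using f by (intro exI[of _ f]) (auto simp: f_def)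
qed

text \<open>For finite \<open>B\<close> the choice is harmless: a finite chain has exactly one
  order-reversing bijection onto itself.\<close>

definition reflection :: "nat set \<Rightarrow> nat \<Rightarrow> nat" where
  "reflection B = (SOME f. (\<forall>x\<in>B. f x \<in> B \<and> f (f x) = x) \<and> (\<forall>x. x \<notin> B \<longrightarrow> f x = x) \<and>
    (\<forall>x\<in>B. \<forall>y\<in>B. f x < f y \<longleftrightarrow> y < x))"

lemma reflection:
  assumes "finite B"
  shows "x \<in> B \<Longrightarrow> reflection B x \<in> B" "reflection B (reflection B x) = x"
    "x \<notin> B \<Longrightarrow> reflection B x = x"
    "x \<in> B \<Longrightarrow> y \<in> B \<Longrightarrow> reflection B x < reflection B y \<longleftrightarrow> y < x"
  using someI_ex[OF ex_order_reversing_involution[OF assms], folded reflection_def] by metis+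

text \<open>The minimum is left out of the reflected set and hence stays fixed. The map depends on
  \<open>p\<close> only through its orbits.\<close>

definition cycle_reflection :: "(nat \<Rightarrow> nat) \<Rightarrow> nat \<Rightarrow> nat" where
  "cycle_reflection p x = reflection (orbit p x - {Min (orbit p x)}) x"

text \<open>Conjugation relabels the letters of every cycle by the reflection, which is its own
  inverse.\<close>

definition cycle_complement :: "(nat \<Rightarrow> nat) \<Rightarrow> nat \<Rightarrow> nat" where
  "cycle_complement p = cycle_reflection p \<circ> p \<circ> cycle_reflection p"

section \<open>Reflection and complementation for an arbitrary permutation\<close>

context
  fixes p :: "nat \<Rightarrow> nat"
  assumes p: "permutation p"
begin

lemma cycle_reflection_in_orbit: "cycle_reflection p x \<in> orbit p x"
  using reflection(1,3)[of "orbit p x - {Min (orbit p x)}" x] finite_orbit_permutation[OF p]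
    permutation_self_in_orbit[OF p, of x]
  unfolding cycle_reflection_def by (cases "x = Min (orbit p x)") auto

lemma orbit_cycle_reflection: "orbit p (cycle_reflection p x) = orbit p x"
  by (rule orbit_eqI_permutation[OF p cycle_reflection_in_orbit])

lemma cycle_reflection_involution: "cycle_reflection p (cycle_reflection p x) = x"
  using reflection(2) finite_orbit_permutation[OF p] orbit_cycle_reflection[of x]
  unfolding cycle_reflection_def by simp

lemma orbit_min_cycle_reflection: "orbit_min p (cycle_reflection p x) \<longleftrightarrow> orbit_min p x"
proof -
  have fix_min: "cycle_reflection p y = y" if "orbit_min p y" for y
    using that reflection(3) finite_orbit_permutation[OF p]
    unfolding orbit_min_iff_Min[OF p] cycle_reflection_def by simp
  \<comment> \<open>If the image of \<open>x\<close> is a minimum, it is fixed, and the involution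
    makes it equal to \<open>x\<close>.\<close>
  show ?thesis using fix_min cycle_reflection_involution by metis
qed

lemma cycle_reflection_less:
  assumes "y \<in> orbit p x" "\<not> orbit_min p x" "\<not> orbit_min p y"
  shows "cycle_reflection p x < cycle_reflection p y \<longleftrightarrow> y < x"
proof -
  have "orbit p y = orbit p x" using orbit_eqI_permutation[OF p assms(1)] .
  then show ?thesis
    using assms reflection(4)[of "orbit p x - {Min (orbit p x)}" x y]
      finite_orbit_permutation[OF p] permutation_self_in_orbit[OF p, of x]
    unfolding orbit_min_iff_Min[OF p] cycle_reflection_def by simp
qed

text \<open>Conjugation carries orbits to their images under the reflection, and the reflection maps
  every orbit onto itself.\<close>

lemma orbit_cycle_complement: "orbit (cycle_complement p) x = orbit p x"
proof -
  let ?r = "cycle_reflection p"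
  have "?r ` orbit p (?r x) = orbit (cycle_complement p) (?r (?r x))"
    by (rule orbit_inverse)
      (simp_all add: permutation_self_in_orbit p cycle_complement_def cycle_reflection_involution)
  moreover have "?r y \<in> orbit p x" if "y \<in> orbit p x" for y
    using orbit_eqI_permutation[OF p that] cycle_reflection_in_orbit by blast
  then have "?r ` orbit p x = orbit p x"
    using cycle_reflection_involution by (metis image_eqI image_subsetI subsetI subset_antisym)
  ultimately show ?thesis by (simp add: orbit_cycle_reflection cycle_reflection_involution)
qed

text \<open>Equal orbits give equal reflections, so the second conjugation undoes the first.\<close>

lemma cycle_complement_involution: "cycle_complement (cycle_complement p) = p"
proof -
  have "cycle_reflection (cycle_complement p) = cycle_reflection p"
    by (simp add: fun_eq_iff cycle_reflection_def orbit_cycle_complement)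
  then have "cycle_complement (cycle_complement p) =
      cycle_reflection p \<circ> cycle_complement p \<circ> cycle_reflection p"
    by (subst cycle_complement_def) simp
  then show ?thesis by (simp add: fun_eq_iff cycle_complement_def cycle_reflection_involution)
qed

end

section \<open>Complementation on permutations of {1..n}\<close>

lemma cycle_reflection_in_iff:
  assumes "p permutes {1..n}"
  shows "cycle_reflection p x \<in> {1..n} \<longleftrightarrow> x \<in> {1..n}"
proof -
  have p: "permutation p" using assms permutation_permutes by blast
  have "cycle_reflection p y \<in> {1..n}" if "y \<in> {1..n}" for y
    using permutes_orbit_subset[OF assms that] cycle_reflection_in_orbit[OF p] by blast
  then show ?thesis using cycle_reflection_involution[OF p] by metis
qed

lemma cycle_complement_permutes:
  assumes "p permutes {1..n}"
  shows "cycle_complement p permutes {1..n}"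
proof -
  have p: "permutation p" using assms permutation_permutes by blast
  have "bij (cycle_reflection p)"
    by (rule involuntory_imp_bij) (rule cycle_reflection_involution[OF p])
  then have "bij (cycle_complement p)"
    unfolding cycle_complement_def using permutes_bij[OF assms] by (intro bij_comp)
  moreover have "cycle_complement p x = x" if "x \<notin> {1..n}" for x
    using that assms cycle_reflection_in_iff[OF assms, of x] cycle_reflection_involution[OF p]
    by (simp add: cycle_complement_def permutes_not_in del: atLeastAtMost_iff)
  ultimately show ?thesis by (auto simp: permutes_def bij_iff)
qed

text \<open>The reflection reverses the order among non-minimal letters of one cycle, so
  \<open>b < a < c\<close> in the triple \<open>a, b, c\<close> becomes the order relation of
  231.\<close>

lemma occ_cycle_complement:
  assumes perm: "p permutes {1..n}"
  shows "occ [2,3,1] n (cycle_complement p) = occ [2,1,3] n p"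
proof -
  let ?r = "cycle_reflection p" and ?c = "cycle_complement p"
  have p: "permutation p" using perm permutation_permutes by blast
  note inv = cycle_reflection_involution[OF p]
  have om: "orbit_min ?c = orbit_min p"
    by (simp add: fun_eq_iff orbit_min_def orbit_cycle_complement[OF p])
  have c: "?c x = ?r (p (?r x))" for x by (simp add: cycle_complement_def)
  have iff: "?r a \<in> interior_occ [2,3,1] n ?c \<longleftrightarrow> a \<in> interior_occ [2,1,3] n p" for a
  proof (cases "orbit_min p a \<or> orbit_min p (p a) \<or> orbit_min p (p (p a))")
    case True
    then show ?thesis
      by (auto simp: interior_occ_def om c inv orbit_min_cycle_reflection[OF p])
  next
    case False
    \<comment> \<open>Order reversal holds only within one orbit; these memberships cover the two
      comparisons that decide the patterns.\<close>
    have "p a \<in> orbit p a" "a \<in> orbit p (p (p a))"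
      using permutation_self_in_orbit[OF p] permutation_orbit_step[OF p] by blast+
    then have "?r (p (p a)) < ?r a \<longleftrightarrow> a < p (p a)" "?r a < ?r (p a) \<longleftrightarrow> p a < a"
      using False cycle_reflection_less[OF p] by blast+
    then show ?thesis
      using False by (auto simp: interior_occ_def om c inv orbit_min_cycle_reflection[OF p]
        cycle_reflection_in_iff[OF perm] order_isomorphic_triple simp del: atLeastAtMost_iff One_nat_def)
  qed
  have "bij_betw ?r (interior_occ [2,1,3] n p) (interior_occ [2,3,1] n ?c)"
    by (rule bij_betw_byWitness[where f' = ?r]) (use iff inv in \<open>force+\<close>)
  then have "card (interior_occ [2,1,3] n p) = card (interior_occ [2,3,1] n ?c)"
    by (rule bij_betw_same_card)
  moreover have "occ [2,1,3] n p = card (interior_occ [2,1,3] n p)"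
    by (rule occ_eq_card_interior_occ[OF perm]) (auto simp only: order_isomorphic_triple)
  moreover have "occ [2,3,1] n ?c = card (interior_occ [2,3,1] n ?c)"
    by (rule occ_eq_card_interior_occ[OF cycle_complement_permutes[OF perm]])
      (auto simp only: order_isomorphic_triple)
  ultimately show ?thesis by simp
qed

lemma F_213_231: "F [2,1,3] = F [2,3,1]"
proof (rule F_eqI[where f = cycle_complement])
  fix n and p :: "nat \<Rightarrow> nat" assume p: "p permutes {1..n}"
  then have perm: "permutation p" using permutation_permutes by blast
  show "cycle_complement p permutes {1..n} \<and> cycle_complement (cycle_complement p) = p"
    using cycle_complement_permutes[OF p] cycle_complement_involution[OF perm] ..
  show "cyc n (cycle_complement p) = cyc n p"
    by (rule cyc_cong_orbit) (rule orbit_cycle_complement[OF perm])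
qed (rule occ_cycle_complement)

theorem mainTheorem4:
  shows "F [2,1,3] = F [2,3,1] \<and> F [2,3,1] = F [3,1,2]"
  using F_213_231 F_213_312 by simp

end
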